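(* Let $(x(t),y(t),z(t))$ be an S-periodic helix with parameters $c_1,c_2,m,\ell,a$. Then the following assertions are valid for all $t\in\mathbb{R}$. 1. If $c_1c_2>0$, then $$x^2(t)+y^2(t)+z^2(t)=(c_1+c_2)^2+(a^2-4c_1c_2)\sin^2\Big(\frac{\ell-m}{2}t\Big).$$ 2. If $c_1c_2<0$, then $$x^2(t)+y^2(t)-z^2(t)=(c_1+c_2)^2-(a^2+4c_1c_2)\sin^2\Big(\frac{\ell-m}{2}t\Big).$$
   Context: A periodic helix is here a curve in $\mathbb{R}^3$ of the form $$x(t)=c_1\cos(mt)+c_2\cos(\ell t),\quad y(t)=c_1\sin(mt)+c_2\sin(\ell t),\quad z(t)=a\sin(\theta+Qt),$$ where $c_1,c_2,a,\theta,Q$ are real, $m,\ell$ are integers and $\ell>|m|$. It is called an S-periodic helix if $\theta=0$ and $Q=(\ell-m)/2$. *)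

theory Defs
  imports "HOL-Analysis.Analysis"
begin

definition periodic_helix ::
  "real \<Rightarrow> real \<Rightarrow> int \<Rightarrow> int \<Rightarrow> real \<Rightarrow> real \<Rightarrow> real \<Rightarrow> (real \<Rightarrow> real^3) \<Rightarrow> bool"
where
  "periodic_helix c1 c2 m l a \<theta> Q \<gamma> \<longleftrightarrow>
     l > \<bar>m\<bar> \<and>
     (\<forall>t. \<gamma> t = vector
        [c1 * cos (of_int m * t) + c2 * cos (of_int l * t),
         c1 * sin (of_int m * t) + c2 * sin (of_int l * t),
         a * sin (\<theta> + Q * t)])"

definition S_periodic_helix ::
  "real \<Rightarrow> real \<Rightarrow> int \<Rightarrow> int \<Rightarrow> real \<Rightarrow> (real \<Rightarrow> real^3) \<Rightarrow> bool"
where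
  "S_periodic_helix c1 c2 m l a \<gamma> \<longleftrightarrow>
     periodic_helix c1 c2 m l a 0 (of_int (l - m) / 2) \<gamma>"

end

theory Submission
  imports Defs
begin

text \<open>
  The projection of the curve to the horizontal plane is a sum of two vectors of signed lengths
  \<open>c1\<close> and \<open>c2\<close> that enclose the angle \<open>(l - m) * t\<close>. By the law of cosines and
  the half-angle identity, its squared length is a constant minus \<open>4 * c1 * c2\<close> times
  \<open>(sin ((l - m) / 2 * t))\<^sup>2\<close>
  (lemma \<open>norm_sq_sum_of_rotating_vectors\<close>). For an S-periodic helix the squared height
  is \<open>a\<^sup>2\<close> times that very same squared sine, so adding or subtracting it only changes the
  coefficient.
\<close>

text \<open>
  Expanding the squares leaves \<open>2 * c * d * cos (v - u)\<close> as the only cross term. Writing this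
  cosine through the sine of half the angle, as \<open>1 - 2 * (sin ((v - u) / 2))\<^sup>2\<close>, completes
  the square \<open>(c + d)\<^sup>2\<close>.
\<close>

lemma norm_sq_sum_of_rotating_vectors:
  fixes c d u v :: real
  shows "(c * cos u + d * cos v)\<^sup>2 + (c * sin u + d * sin v)\<^sup>2 =
    (c + d)\<^sup>2 - 4 * c * d * (sin ((v - u) / 2))\<^sup>2"
proof -
  have "(c * cos u + d * cos v)\<^sup>2 + (c * sin u + d * sin v)\<^sup>2 =
      c\<^sup>2 * ((cos u)\<^sup>2 + (sin u)\<^sup>2) + d\<^sup>2 * ((cos v)\<^sup>2 + (sin v)\<^sup>2)
      + 2 * c * d * (cos v * cos u + sin v * sin u)"
    by algebra
  also have "\<dots> = c\<^sup>2 + d\<^sup>2 + 2 * c * d * cos (v - u)"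
    by (simp add: cos_diff)
  also have "cos (v - u) = 1 - 2 * (sin ((v - u) / 2))\<^sup>2"
    using cos_double_sin[of "(v - u) / 2"] by (simp only: mult_2 field_sum_of_halves)
  finally show ?thesis
    by (simp add: power2_eq_square algebra_simps)
qed

theorem theorem12p6:
  fixes c1 c2 a :: real and m l :: int and \<gamma> :: "real \<Rightarrow> real^3"
  assumes "S_periodic_helix c1 c2 m l a \<gamma>"
  shows "\<forall>t::real.
     (c1 * c2 > 0 \<longrightarrow>
        (\<gamma> t $ 1)\<^sup>2 + (\<gamma> t $ 2)\<^sup>2 + (\<gamma> t $ 3)\<^sup>2 =
          (c1 + c2)\<^sup>2 + (a\<^sup>2 - 4 * c1 * c2) * (sin (of_int (l - m) / 2 * t))\<^sup>2) \<and>
     (c1 * c2 < 0 \<longrightarrow>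
        (\<gamma> t $ 1)\<^sup>2 + (\<gamma> t $ 2)\<^sup>2 - (\<gamma> t $ 3)\<^sup>2 =
          (c1 + c2)\<^sup>2 - (a\<^sup>2 + 4 * c1 * c2) * (sin (of_int (l - m) / 2 * t))\<^sup>2)"
proof
  fix t :: real
  let ?s = "sin (of_int (l - m) / 2 * t)"
  have \<gamma>: "\<gamma> t $ 1 = c1 * cos (of_int m * t) + c2 * cos (of_int l * t)"
    "\<gamma> t $ 2 = c1 * sin (of_int m * t) + c2 * sin (of_int l * t)"
    "\<gamma> t $ 3 = a * ?s"
    using assms by (simp_all add: S_periodic_helix_def periodic_helix_def)
  have angle: "(of_int l * t - of_int m * t) / 2 = of_int (l - m) / 2 * t"
    by (simp add: left_diff_distrib)
  have horizontal: "(\<gamma> t $ 1)\<^sup>2 + (\<gamma> t $ 2)\<^sup>2 = (c1 + c2)\<^sup>2 - 4 * c1 * c2 * ?s\<^sup>2"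
    unfolding \<gamma> norm_sq_sum_of_rotating_vectors angle ..
  have height: "(\<gamma> t $ 3)\<^sup>2 = a\<^sup>2 * ?s\<^sup>2"
    unfolding \<gamma> by (rule power_mult_distrib)
  show "(c1 * c2 > 0 \<longrightarrow>
        (\<gamma> t $ 1)\<^sup>2 + (\<gamma> t $ 2)\<^sup>2 + (\<gamma> t $ 3)\<^sup>2 =
          (c1 + c2)\<^sup>2 + (a\<^sup>2 - 4 * c1 * c2) * ?s\<^sup>2) \<and>
     (c1 * c2 < 0 \<longrightarrow>
        (\<gamma> t $ 1)\<^sup>2 + (\<gamma> t $ 2)\<^sup>2 - (\<gamma> t $ 3)\<^sup>2 =
          (c1 + c2)\<^sup>2 - (a\<^sup>2 + 4 * c1 * c2) * ?s\<^sup>2)"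
    unfolding horizontal height by (simp add: left_diff_distrib distrib_right)
qed

end
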